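(* Let $\sigma$ be an admissibility-based argumentation semantics, and let $\sup(\sigma)$ be the associated JSBAF semantics. Then Deductive ASPIC$-$ satisfies closure, direct consistency and indirect consistency under $\sup(\sigma)$. That is, for every logical language $L$ closed under negation, every consistent argumentation system $AS=(R_s,R_d,n)$ over $L$ and every set $C$ of DA$-$ conclusions of $AS$ under $\sup(\sigma)$: (1) (closure) $Cl_{R_s}(C)=C$; (2) (direct consistency) there is no formula $\phi$ with $\phi,\neg\phi\in C$; (3) (indirect consistency) there is no formula $\phi$ with $\phi,\neg\phi\in Cl_{R_s}(C)$.
   Context: **Argumentation frameworks.** An argumentation framework (AF) is a pair $(Ar,\rightarrow)$ with $Ar$ a (finite or infinite) set and $\rightarrow\subseteq Ar\times Ar$ (the attack relation). A set $S\subseteq Ar$ is conflict-free iff there are no $b,c\in S$ with $b\rightarrow c$; $a\in Ar$ is defended by $S$ iff for every $b\in Ar$ with $b\rightarrow a$ there is $c\in S$ with $c\rightarrow b$; $S$ is admissible iff it is conflict-free and every argument in $S$ is defended by $S$. An argumentation semantics $\sigma$ maps every AF $F=(Ar,\rightarrow)$ to a set $\sigma(F)\subseteq 2^{Ar}$, whose elements are the $\sigma$-extensions of $F$. It is admissibility-based if every $\sigma$-extension of every AF is admissible (the complete, stable, grounded and preferred semantics are examples). **Argumentation systems.** Let $L$ be a logical language closed under negation $\neg$. An argumentation system over $L$ is $AS=(R_s,R_d,n)$, where $R_s$ is a finite set of strict rules $\varphi_1,\dots,\varphi_k\mapsto\varphi$, $R_d$ is a finite set of defeasible rules $\varphi_1,\dots,\varphi_k\rightsquigarrow\varphi$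 (with $k\ge 0$ and $\varphi_i,\varphi\in L$), and $n$ is a partial function $R_d\to L$. We write $\varphi=-\psi$ if $\varphi=\neg\psi$ or $\psi=\neg\varphi$. Arguments on the basis of $AS$ are defined recursively: if $A_1,\dots,A_k$ ($k\ge 0$) are arguments with conclusions $\mathrm{Conc}(A_i)$ and $r$ is a strict rule $\mathrm{Conc}(A_1),\dots,\mathrm{Conc}(A_k)\mapsto\psi$ in $R_s$ (resp. a defeasible rule $\mathrm{Conc}(A_1),\dots,\mathrm{Conc}(A_k)\rightsquigarrow\psi$ in $R_d$), then $A=(A_1,\dots,A_k\mapsto\psi)$ (resp. $A=(A_1,\dots,A_k\rightsquigarrow\psi)$) is an argument, with $\mathrm{Conc}(A)=\psi$, $\mathrm{TopRule}(A)=r$, $\mathrm{Sub}(A)=\mathrm{Sub}(A_1)\cup\dots\cup\mathrm{Sub}(A_k)\cup\{A\}$, and $\mathrm{DefRules}(A)=\bigcup_i\mathrm{DefRules}(A_i)$ in the strict case, $\mathrm{DefRules}(A)=\bigcup_i\mathrm{DefRules}(A_i)\cup\{r\}$ in the defeasible case. $A$ is defeasible iff $\mathrm{DefRules}(A)\ne\emptyset$, and strict otherwise. $AS$ is consistent iff there are no strict arguments $A,B$ on the basis of $AS$ with $\mathrm{Conc}(A)=-\mathrm{Conc}(B)$. $A$ undercuts $B$ iff $\mathrm{Conc}(A)=-n(r)$ for some $B'\in\mathrm{Sub}(B)$ with $\mathrm{TopRule}(B')=r\in R_d$. $A$ unrestrictedly rebuts $B$ iff $\mathrm{Conc}(A)=-\mathrm{Conc}(B')$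 for some defeasible $B'\in\mathrm{Sub}(B)$. For $S\subseteq L$, $Cl_{R_s}(S)$ is the smallest set containing $S$ such that whenever $a_1,\dots,a_m\mapsto b\in R_s$ and $a_1,\dots,a_m\in Cl_{R_s}(S)$, also $b\in Cl_{R_s}(S)$. **JSBAFs.** A Joint Support Bipolar Argumentation Framework (JSBAF) is a triple $(Ar,\rightarrow,\Rightarrow)$ with $\rightarrow\subseteq Ar\times Ar$ and $\Rightarrow\subseteq 2^{Ar}\times Ar$. A JSBAF semantics maps every JSBAF $J=(Ar,\rightarrow,\Rightarrow)$ to a set of subsets of $Ar$, called its extensions. **Flattening.** A higher-level AF is a pair $(Ar,\rightarrow)$ with $\rightarrow\subseteq(2^{Ar}\setminus\{\emptyset\})\times Ar$. For a JSBAF $J=(Ar,\rightarrow,\Rightarrow)$, $\mathrm{flat}_1(J)$ is the higher-level AF $(Ar\cup\{\bar b\mid (X,b)\in\Rightarrow\},\rightarrow_1)$, where $\rightarrow_1$ consists of: $(\{a\},b)$ for each $a\rightarrow b$; $(\{b\},\bar b)$ for each $(X,b)\in\Rightarrow$; and $((X\setminus\{a\})\cup\{\bar b\},a)$ for each $(X,b)\in\Rightarrow$ and $a\in X$. For a higher-level AF $H=(Ar,\rightarrow)$, $\mathrm{flat}_2(H)$ is the AF whose arguments are $Ar\cup\{\bar a\mid a\in X\text{ for some }(X,b)\in\rightarrow,|X|>1\}\cup\{e(X)\mid (X,b)\in\rightarrow\text{ for some }b,\ |X|>1\}$, with attacks $\rightarrow_2$: $a\rightarrow_2 b$ for each $(\{a\},b)\in\rightarrow$;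 and, for each $(X,b)\in\rightarrow$ with $|X|>1$, $e(X)\rightarrow_2 b$, and $a\rightarrow_2\bar a$ and $\bar a\rightarrow_2 e(X)$ for every $a\in X$. Here $\bar x$ and $e(X)$ are new meta-arguments; the same symbol $\bar x$ is used in both steps. Write $\mathrm{flat}_2(\mathrm{flat}_1(J))=(MA',\rightarrow')$. The simplified flattening $\mathrm{flat}(J)$ is the AF $(MA^*,\rightarrow^* )$ with $MA^*=MA'\setminus\{\bar a,\bar{\bar a}\mid (S,a)\in\Rightarrow\text{ for some }S\text{ with }|S|>1\}$ and $\rightarrow^*=\{(a,b)\in MA^*\times MA^*\mid a\rightarrow' b\}\cup\{(a,b)\in MA^*\times MA^*\mid\bar{\bar a}\rightarrow' b\}$. **The semantics $\sup(\sigma)$.** For an argumentation semantics $\sigma$, $E$ is a $\sup(\sigma)$-extension of a JSBAF $J=(Ar,\rightarrow,\Rightarrow)$ iff there is a $\sigma$-extension $E'$ of $\mathrm{flat}(J)$ with $E=E'\cap Ar$. **Deductive ASPIC$-$.** The JSBAF corresponding to $AS$ is $J_{\mathrm{DA}-}(AS)=(Ar,\rightarrow',\Rightarrow')$, where $Ar$ is the set of arguments on the basis of $AS$, $A\rightarrow' B$ iff $A$ undercuts or unrestrictedly rebuts $B$, and $S\Rightarrow' A$ iff $A$ is of the form $S\mapsto\varphi$ for some formula $\varphi$ (i.e. $A=(A_1,\dots,A_k\mapsto\varphi)$ with $S=\{A_1,\dots,A_k\}$). For a JSBAF semantics $\tau$, a set of DA$-$ conclusions of $AS$ under $\tau$ is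 a set $\{\mathrm{Conc}(A)\mid A\in E\}$ for some $\tau$-extension $E$ of $J_{\mathrm{DA}-}(AS)$.
   Formalization: In the definition of Cl, strict rules are applied only when they have at least one premise (m ≥ 1); with premise-free rules the claim fails, e.g. for R_s = {↦ p} and σ(F) = {∅}, where C = ∅ but Cl(C) = {p}. *)

theory Defs
  imports Main
begin

section \<open>Argumentation frameworks\<close>

record 'a af =
  af_args :: "'a set"
  af_att :: "('a \<times> 'a) set"

definition is_af :: "'a af \<Rightarrow> bool" where
  "is_af F \<longleftrightarrow> af_att F \<subseteq> af_args F \<times> af_args F"

definition conflict_free :: "'a af \<Rightarrow> 'a set \<Rightarrow> bool" where
  "conflict_free F S \<longleftrightarrow> S \<subseteq> af_args F \<and> \<not> (\<exists>b\<in>S. \<exists>c\<in>S. (b, c) \<in> af_att F)"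

definition defended :: "'a af \<Rightarrow> 'a set \<Rightarrow> 'a \<Rightarrow> bool" where
  "defended F S a \<longleftrightarrow>
     (\<forall>b\<in>af_args F. (b, a) \<in> af_att F \<longrightarrow> (\<exists>c\<in>S. (c, b) \<in> af_att F))"

definition admissible :: "'a af \<Rightarrow> 'a set \<Rightarrow> bool" where
  "admissible F S \<longleftrightarrow> conflict_free F S \<and> (\<forall>a\<in>S. defended F S a)"

type_synonym 'a semantics = "'a af \<Rightarrow> 'a set set"

definition is_semantics :: "'a semantics \<Rightarrow> bool" where
  "is_semantics \<sigma> \<longleftrightarrow> (\<forall>F. is_af F \<longrightarrow> \<sigma> F \<subseteq> Pow (af_args F))"

definition admissibility_based :: "'a semantics \<Rightarrow> bool" where
  "admissibility_based \<sigma> \<longleftrightarrow> (\<forall>F. is_af F \<longrightarrow> (\<forall>E\<in>\<sigma> F. admissible F E))"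


section \<open>Joint support bipolar argumentation frameworks and flattening\<close>

record 'a jsbaf =
  js_args :: "'a set"
  js_att :: "('a \<times> 'a) set"
  js_sup :: "('a set \<times> 'a) set"

type_synonym 'a jsbaf_semantics = "'a jsbaf \<Rightarrow> 'a set set"

text \<open>Higher-level frameworks: the attackers are (nonempty) sets of arguments.\<close>

record 'a haf =
  haf_args :: "'a set"
  haf_att :: "('a set \<times> 'a) set"

text \<open>
  Both flattening steps use the same symbol for barred arguments, so \<open>Bar (Arg a)\<close>
  introduced by the first step and \<open>Bar (Arg a)\<close> introduced by the second step are
  one and the same meta-argument. The second step adds a bar to elements of a
  higher-level framework, which may be barred already; it never adds one to an \<open>e(X)\<close>.
  The arguments \<open>x\<close> without \<open>e\<close> and the arguments \<open>e(X)\<close> are kept apart by \<open>Plain\<close> and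
  \<open>Joint\<close>.
\<close>

datatype 'a barred = Arg 'a | Bar "'a barred"

datatype 'a meta = Plain "'a barred" | Joint "'a barred set"

text \<open>\<open>|X| > 1\<close>, for possibly infinite \<open>X\<close> (\<open>card\<close> is \<open>0\<close> on infinite sets).\<close>

definition multi :: "'a set \<Rightarrow> bool" where
  "multi X \<longleftrightarrow> infinite X \<or> card X > 1"

definition flat1 :: "'a jsbaf \<Rightarrow> 'a barred haf" where
  "flat1 J =
    \<lparr> haf_args = Arg ` js_args J \<union> {Bar (Arg b) | X b. (X, b) \<in> js_sup J},
      haf_att =
        {({Arg a}, Arg b) | a b. (a, b) \<in> js_att J}
        \<union> {({Arg b}, Bar (Arg b)) | X b. (X, b) \<in> js_sup J}
        \<union> {(Arg ` (X - {a}) \<union> {Bar (Arg b)}, Arg a) | X a b. (X, b) \<in> js_sup J \<and> a \<in> X} \<rparr>"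

definition flat2 :: "'a barred haf \<Rightarrow> 'a meta af" where
  "flat2 H =
    \<lparr> af_args =
        Plain ` haf_args H
        \<union> {Plain (Bar a) | a X b. (X, b) \<in> haf_att H \<and> multi X \<and> a \<in> X}
        \<union> {Joint X | X b. (X, b) \<in> haf_att H \<and> multi X},
      af_att =
        {(Plain a, Plain b) | a b. ({a}, b) \<in> haf_att H}
        \<union> {(Joint X, Plain b) | X b. (X, b) \<in> haf_att H \<and> multi X}
        \<union> {(Plain a, Plain (Bar a)) | a X b. (X, b) \<in> haf_att H \<and> multi X \<and> a \<in> X}
        \<union> {(Plain (Bar a), Joint X) | a X b. (X, b) \<in> haf_att H \<and> multi X \<and> a \<in> X} \<rparr>"

definition flat_args :: "'a jsbaf \<Rightarrow> 'a meta set" where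
  "flat_args J =
     af_args (flat2 (flat1 J))
     - ({Plain (Bar (Arg a)) | S a. (S, a) \<in> js_sup J \<and> multi S}
        \<union> {Plain (Bar (Bar (Arg a))) | S a. (S, a) \<in> js_sup J \<and> multi S})"

definition flat :: "'a jsbaf \<Rightarrow> 'a meta af" where
  "flat J =
    \<lparr> af_args = flat_args J,
      af_att =
        {(x, y) \<in> flat_args J \<times> flat_args J. (x, y) \<in> af_att (flat2 (flat1 J))}
        \<union> {(Plain z, y) | z y. Plain z \<in> flat_args J \<and> y \<in> flat_args J \<and>
             (Plain (Bar (Bar z)), y) \<in> af_att (flat2 (flat1 J))} \<rparr>"

text \<open>\<open>E = E' \<inter> Ar\<close>, where \<open>a \<in> Ar\<close> occurs in the flattening as \<open>Plain (Arg a)\<close>.\<close>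

definition sup_sem :: "'a meta semantics \<Rightarrow> 'a jsbaf_semantics" where
  "sup_sem \<sigma> J = {E. \<exists>E'\<in>\<sigma> (flat J). E = {a \<in> js_args J. Plain (Arg a) \<in> E'}}"


section \<open>Argumentation systems\<close>

text \<open>A logical language is given by a set \<open>L\<close> of formulas and a negation \<open>neg\<close>.\<close>

definition closed_under_neg :: "('l \<Rightarrow> 'l) \<Rightarrow> 'l set \<Rightarrow> bool" where
  "closed_under_neg neg L \<longleftrightarrow> (\<forall>\<phi>\<in>L. neg \<phi> \<in> L)"

text \<open>\<open>opposite neg \<phi> \<psi>\<close> is written \<open>\<phi> = -\<psi>\<close> in the literature.\<close>

definition opposite :: "('l \<Rightarrow> 'l) \<Rightarrow> 'l \<Rightarrow> 'l \<Rightarrow> bool" where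
  "opposite neg \<phi> \<psi> \<longleftrightarrow> \<phi> = neg \<psi> \<or> \<psi> = neg \<phi>"

datatype 'l strict_rule = SRule (sbody: "'l list") (shead: 'l)

datatype 'l def_rule = DRule (dbody: "'l list") (dhead: 'l)

record 'l arg_system =
  srules :: "'l strict_rule set"
  drules :: "'l def_rule set"
  rname :: "'l def_rule \<rightharpoonup> 'l"

definition arg_system_over :: "'l set \<Rightarrow> 'l arg_system \<Rightarrow> bool" where
  "arg_system_over L AS \<longleftrightarrow>
     finite (srules AS) \<and> finite (drules AS) \<and>
     (\<forall>r\<in>srules AS. set (sbody r) \<subseteq> L \<and> shead r \<in> L) \<and>
     (\<forall>r\<in>drules AS. set (dbody r) \<subseteq> L \<and> dhead r \<in> L) \<and>
     dom (rname AS) \<subseteq> drules AS \<and> ran (rname AS) \<subseteq> L"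

datatype 'l argument =
    StrictArg "'l argument list" 'l
  | DefArg "'l argument list" 'l

fun conc :: "'l argument \<Rightarrow> 'l" where
  "conc (StrictArg As \<psi>) = \<psi>"
| "conc (DefArg As \<psi>) = \<psi>"

fun top_rule :: "'l argument \<Rightarrow> 'l strict_rule + 'l def_rule" where
  "top_rule (StrictArg As \<psi>) = Inl (SRule (map conc As) \<psi>)"
| "top_rule (DefArg As \<psi>) = Inr (DRule (map conc As) \<psi>)"

fun sub :: "'l argument \<Rightarrow> 'l argument set" where
  "sub (StrictArg As \<psi>) = (\<Union>A\<in>set As. sub A) \<union> {StrictArg As \<psi>}"
| "sub (DefArg As \<psi>) = (\<Union>A\<in>set As. sub A) \<union> {DefArg As \<psi>}"

fun def_rules :: "'l argument \<Rightarrow> 'l def_rule set" where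
  "def_rules (StrictArg As \<psi>) = (\<Union>A\<in>set As. def_rules A)"
| "def_rules (DefArg As \<psi>) = (\<Union>A\<in>set As. def_rules A) \<union> {DRule (map conc As) \<psi>}"

inductive_set arguments :: "'l arg_system \<Rightarrow> 'l argument set" for AS :: "'l arg_system" where
  strict: "\<lbrakk>\<forall>A\<in>set As. A \<in> arguments AS; SRule (map conc As) \<psi> \<in> srules AS\<rbrakk>
    \<Longrightarrow> StrictArg As \<psi> \<in> arguments AS"
| defeasible: "\<lbrakk>\<forall>A\<in>set As. A \<in> arguments AS; DRule (map conc As) \<psi> \<in> drules AS\<rbrakk>
    \<Longrightarrow> DefArg As \<psi> \<in> arguments AS"

definition is_defeasible :: "'l argument \<Rightarrow> bool" where
  "is_defeasible A \<longleftrightarrow> def_rules A \<noteq> {}"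

definition is_strict :: "'l argument \<Rightarrow> bool" where
  "is_strict A \<longleftrightarrow> \<not> is_defeasible A"

definition consistent :: "('l \<Rightarrow> 'l) \<Rightarrow> 'l arg_system \<Rightarrow> bool" where
  "consistent neg AS \<longleftrightarrow>
     \<not> (\<exists>A\<in>arguments AS. \<exists>B\<in>arguments AS.
          is_strict A \<and> is_strict B \<and> opposite neg (conc A) (conc B))"

definition undercuts :: "('l \<Rightarrow> 'l) \<Rightarrow> 'l arg_system \<Rightarrow> 'l argument \<Rightarrow> 'l argument \<Rightarrow> bool" where
  "undercuts neg AS A B \<longleftrightarrow>
     (\<exists>B'\<in>sub B. \<exists>r\<in>drules AS. \<exists>\<nu>.
        top_rule B' = Inr r \<and> rname AS r = Some \<nu> \<and> opposite neg (conc A) \<nu>)"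

definition unrestrictedly_rebuts :: "('l \<Rightarrow> 'l) \<Rightarrow> 'l argument \<Rightarrow> 'l argument \<Rightarrow> bool" where
  "unrestrictedly_rebuts neg A B \<longleftrightarrow>
     (\<exists>B'\<in>sub B. is_defeasible B' \<and> opposite neg (conc A) (conc B'))"

text \<open>
  Closure under strict rules. A rule \<open>a\<^sub>1, \<dots>, a\<^sub>m \<mapsto> b\<close> is applied here only for
  \<open>m \<ge> 1\<close>. With \<open>m = 0\<close> admitted, the closure of the empty set would contain the heads of all
  premise-free strict rules, whereas the empty set is admissible in every framework and hence
  the empty set of conclusions is obtained under some admissibility-based semantics.
  Premise-free rules do form arguments, see \<open>arguments\<close>.
\<close>

inductive_set strict_closure :: "'l strict_rule set \<Rightarrow> 'l set \<Rightarrow> 'l set"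
  for R :: "'l strict_rule set" and S :: "'l set" where
  base: "a \<in> S \<Longrightarrow> a \<in> strict_closure R S"
| step: "\<lbrakk>SRule as b \<in> R; as \<noteq> []; \<forall>a\<in>set as. a \<in> strict_closure R S\<rbrakk>
    \<Longrightarrow> b \<in> strict_closure R S"


section \<open>Deductive ASPIC-\<close>

definition J_DA :: "('l \<Rightarrow> 'l) \<Rightarrow> 'l arg_system \<Rightarrow> 'l argument jsbaf" where
  "J_DA neg AS =
    \<lparr> js_args = arguments AS,
      js_att = {(A, B) \<in> arguments AS \<times> arguments AS.
                  undercuts neg AS A B \<or> unrestrictedly_rebuts neg A B},
      js_sup = {(set As, StrictArg As \<phi>) | As \<phi>. StrictArg As \<phi> \<in> arguments AS} \<rparr>"

definition DA_conclusions ::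
  "('l \<Rightarrow> 'l) \<Rightarrow> 'l arg_system \<Rightarrow> 'l argument jsbaf_semantics \<Rightarrow> 'l set set" where
  "DA_conclusions neg AS \<tau> = {conc ` E | E. E \<in> \<tau> (J_DA neg AS)}"

end

(*
  The flattening turns a support of b by X into attacks on the members of X that only b can
  answer: for X = {a} the attacker of a is the bar of b; for larger X it is a joint argument
  whose other attackers are bars of members of X, hence in conflict with X. An admissible set
  that contains X therefore contains b, which gives closure under strict rules. Two opposite
  conclusions come from arguments that cannot both be strict, and a defeasible one among them
  is rebutted by the other.
*)
theory Submission
  imports Defs
begin

text \<open>This form covers infinite sets too, so later proofs need no case split on
  finiteness.\<close>

lemma multi_iff: "multi X \<longleftrightarrow> (\<exists>x\<in>X. \<exists>y\<in>X. x \<noteq> y)"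
proof (cases "finite X")
  case True
  then show ?thesis
    unfolding multi_def using card_le_Suc0_iff_eq[OF True] by (auto simp: not_less[symmetric])
next
  case False
  then obtain x where "x \<in> X" by (metis finite.emptyI ex_in_conv)
  moreover have "X - {x} \<noteq> {}" using False by (metis finite.simps finite_Diff2)
  ultimately show ?thesis using False unfolding multi_def by auto
qed

lemma is_af_flat: "is_af (flat J)"
  unfolding is_af_def flat_def by auto

lemma Arg_in_flat_args: "a \<in> js_args J \<Longrightarrow> Plain (Arg a) \<in> flat_args J"
  unfolding flat_args_def flat2_def flat1_def by auto

lemma flat_att_ArgI:
  assumes "(a, b) \<in> js_att J" "a \<in> js_args J" "b \<in> js_args J"
  shows "(Plain (Arg a), Plain (Arg b)) \<in> af_att (flat J)"
  using assms Arg_in_flat_args[of a J] Arg_in_flat_args[of b J]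
  unfolding flat_def flat2_def flat1_def by auto

text \<open>The second flattening bars only members of joint attackers. A second member
  \<open>c\<close> of \<open>X\<close> supplies one: the set attacking \<open>c\<close> contains
  both \<open>Arg a\<close> and \<open>Bar (Arg b)\<close>.\<close>

lemma flat_att_Arg_BarI:
  assumes "a \<in> js_args J" "(X, b) \<in> js_sup J" "multi X" "a \<in> X"
    "Plain (Bar (Arg a)) \<in> flat_args J"
  shows "(Plain (Arg a), Plain (Bar (Arg a))) \<in> af_att (flat J)"
proof -
  obtain c where c: "c \<in> X" "c \<noteq> a" using assms(3,4) unfolding multi_iff by metis
  let ?Y = "Arg ` (X - {c}) \<union> {Bar (Arg b)}"
  have "(?Y, Arg c) \<in> haf_att (flat1 J)"
    unfolding flat1_def using assms c by auto
  moreover have "multi ?Y" "Arg a \<in> ?Y" unfolding multi_iff using assms c by auto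
  ultimately have "(Plain (Arg a), Plain (Bar (Arg a))) \<in> af_att (flat2 (flat1 J))"
    unfolding flat2_def by (simp, blast)
  then show ?thesis
    using Arg_in_flat_args[OF assms(1)] assms(5) unfolding flat_def by simp
qed

text \<open>Attacks inherited from a double bar hit only arguments \<open>Joint Y\<close>, and no
  joint attacker targets a bar. In both flattening steps this leaves the attack of an argument on
  its own bar.\<close>

lemma attacker_of_Bar:
  assumes "(x, Plain (Bar (Arg b))) \<in> af_att (flat J)"
  shows "x = Plain (Arg b)"
  using assms unfolding flat_def flat2_def flat1_def by (auto simp: multi_iff)

text \<open>The second case stems from the simplification: \<open>z\<close> inherits the attacks of
  \<open>Bar (Bar z)\<close>, which attacks \<open>Joint Y\<close> when \<open>Bar z\<close> is in
  \<open>Y\<close>.\<close>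

lemma attacker_of_Joint:
  assumes "(x, Joint Y) \<in> af_att (flat J)"
  shows "(\<exists>y\<in>Y. x = Plain (Bar y)) \<or> (\<exists>z. Bar z \<in> Y \<and> x = Plain z)"
  using assms unfolding flat_def flat2_def by auto

text \<open>Uniqueness of the supporting set matters: a second, larger support of \<open>b\<close> would remove
  the bar of \<open>b\<close> from the simplified flattening, and with it the support by a singleton.\<close>

lemma admissible_flat_support:
  assumes adm: "admissible (flat J) E"
    and sup: "(X, b) \<in> js_sup J" and unique: "\<And>Y. (Y, b) \<in> js_sup J \<Longrightarrow> Y = X"
    and X: "X \<subseteq> js_args J" "X \<noteq> {}" and XE: "\<And>a. a \<in> X \<Longrightarrow> Plain (Arg a) \<in> E"
  shows "Plain (Arg b) \<in> E"
proof -
  have E: "E \<subseteq> flat_args J" and cf: "\<And>x y. x \<in> E \<Longrightarrow> y \<in> E \<Longrightarrow> (x, y) \<notin> af_att (flat J)"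
    using adm unfolding admissible_def conflict_free_def by (auto simp: flat_def)
  have counter: "\<exists>z\<in>E. (z, y) \<in> af_att (flat J)"
    if "x \<in> E" "y \<in> flat_args J" "(y, x) \<in> af_att (flat J)" for x y
    using adm that unfolding admissible_def defended_def by (auto simp: flat_def)
  obtain a where a: "a \<in> X" using X by auto
  have aF: "Plain (Arg a) \<in> flat_args J" using a X(1) by (intro Arg_in_flat_args) auto
  let ?Y = "Arg ` (X - {a}) \<union> {Bar (Arg b)}"
  have Y: "(?Y, Arg a) \<in> haf_att (flat1 J)" using sup a unfolding flat1_def by auto
  show ?thesis
  proof (cases "multi X")
    case False
    \<comment> \<open>Here \<open>X\<close> is \<open>{a}\<close>, so the attacking set is a
      singleton and \<open>flat2\<close> keeps a direct attack from the bar of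
      \<open>b\<close>.\<close>
    then have "X - {a} = {}" using a unfolding multi_iff by blast
    then have single: "?Y = {Bar (Arg b)}" by (simp only: image_empty Un_empty_left)
    have "\<not> multi S" if "(S, b) \<in> js_sup J" for S using unique[OF that] False by simp
    moreover have "Bar (Arg b) \<in> haf_args (flat1 J)" using sup unfolding flat1_def by auto
    ultimately have bF: "Plain (Bar (Arg b)) \<in> flat_args J"
      unfolding flat_args_def flat2_def by simp
    have "(Plain (Bar (Arg b)), Plain (Arg a)) \<in> af_att (flat2 (flat1 J))"
      using Y unfolding single flat2_def by simp
    then have "(Plain (Bar (Arg b)), Plain (Arg a)) \<in> af_att (flat J)"
      using bF aF unfolding flat_def by auto
    from counter[OF XE[OF a] bF this] show ?thesis using attacker_of_Bar by metis
  next
    case True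
    then obtain c where "c \<in> X" "c \<noteq> a" using a unfolding multi_iff by metis
    then have mY: "multi ?Y" unfolding multi_iff by auto
    have JF: "Joint ?Y \<in> flat_args J"
      using Y mY unfolding flat_args_def flat2_def by simp blast
    have "(Joint ?Y, Plain (Arg a)) \<in> af_att (flat2 (flat1 J))"
      using Y mY unfolding flat2_def by simp
    then have "(Joint ?Y, Plain (Arg a)) \<in> af_att (flat J)"
      using JF aF unfolding flat_def by auto
    from counter[OF XE[OF a] JF this]
    obtain z where z: "z \<in> E" "(z, Joint ?Y) \<in> af_att (flat J)" by auto
    from z(2) consider c where "c \<in> X" "z = Plain (Bar (Arg c))"
      | "z = Plain (Bar (Bar (Arg b)))" | "z = Plain (Arg b)"
      using attacker_of_Joint[of z ?Y J] by auto
    then show ?thesis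
    proof cases
      case 1
      \<comment> \<open>The member \<open>c\<close> of \<open>X\<close> lies in \<open>E\<close> and
        attacks its own bar, so \<open>E\<close> would not be conflict-free.\<close>
      then have "(Plain (Arg c), z) \<in> af_att (flat J)"
        using flat_att_Arg_BarI[OF _ sup True] X z E by auto
      then show ?thesis using cf XE 1 z by blast
    next
      case 2
      \<comment> \<open>The double bar of \<open>b\<close> is deleted in \<open>flat_args\<close>,
        because \<open>b\<close> has a support with several members.\<close>
      then show ?thesis using z E sup True unfolding flat_args_def by auto
    next
      case 3
      then show ?thesis using z by simp
    qed
  qed
qed

lemma opposite_commute: "opposite neg \<phi> \<psi> \<longleftrightarrow> opposite neg \<psi> \<phi>"
  unfolding opposite_def by auto

lemma self_in_sub: "A \<in> sub A"
  by (cases A) auto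

lemma strict_closure_eqI:
  assumes "\<And>as b. SRule as b \<in> R \<Longrightarrow> as \<noteq> [] \<Longrightarrow> set as \<subseteq> S \<Longrightarrow> b \<in> S"
  shows "strict_closure R S = S"
proof
  show "strict_closure R S \<subseteq> S"
  proof
    fix x assume "x \<in> strict_closure R S"
    then show "x \<in> S" by induction (use assms in auto)
  qed
qed (auto intro: strict_closure.base)

context
  fixes neg :: "'l \<Rightarrow> 'l" and AS :: "'l arg_system" and E :: "'l argument meta set"
  assumes adm: "admissible (flat (J_DA neg AS)) E"
begin

text \<open>A strict argument records its immediate subarguments, so \<open>set As\<close> is its
  only support, as \<open>admissible_flat_support\<close> demands.\<close>

lemma StrictArg_in_admissible:
  assumes "StrictArg As \<phi> \<in> arguments AS" "As \<noteq> []" "\<And>A. A \<in> set As \<Longrightarrow> Plain (Arg A) \<in> E"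
  shows "Plain (Arg (StrictArg As \<phi>)) \<in> E"
proof (rule admissible_flat_support[OF adm])
  show "(set As, StrictArg As \<phi>) \<in> js_sup (J_DA neg AS)"
    using assms unfolding J_DA_def by auto
  show "set As \<subseteq> js_args (J_DA neg AS)"
    using assms(1) by (auto simp: J_DA_def elim: arguments.cases)
qed (use assms in \<open>auto simp: J_DA_def\<close>)

lemma strict_closure_admissible_conclusions:
  fixes C
  defines "C \<equiv> conc ` {A \<in> arguments AS. Plain (Arg A) \<in> E}"
  shows "strict_closure (srules AS) C = C"
proof (rule strict_closure_eqI)
  fix as b
  assume r: "SRule as b \<in> srules AS" "as \<noteq> []" "set as \<subseteq> C"
  then have "\<forall>a\<in>set as. \<exists>A. A \<in> arguments AS \<and> Plain (Arg A) \<in> E \<and> conc A = a"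
    unfolding C_def by auto
  \<comment> \<open>Choosing one accepted argument per premise lets the rule be applied on top of
    them.\<close>
  then obtain f where f: "\<And>a. a \<in> set as \<Longrightarrow>
      f a \<in> arguments AS \<and> Plain (Arg (f a)) \<in> E \<and> conc (f a) = a"
    by metis
  have "map conc (map f as) = as" using f by (simp add: map_idI)
  then have B: "StrictArg (map f as) b \<in> arguments AS"
    using f r by (intro arguments.strict) auto
  then have "Plain (Arg (StrictArg (map f as) b)) \<in> E"
    using f r by (intro StrictArg_in_admissible) auto
  with B show "b \<in> C" unfolding C_def by force
qed

lemma admissible_conclusions_not_opposite:
  assumes "consistent neg AS"
    and A: "A \<in> arguments AS" "Plain (Arg A) \<in> E" and B: "B \<in> arguments AS" "Plain (Arg B) \<in> E"
  shows "\<not> opposite neg (conc A) (conc B)"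
proof
  \<comment> \<open>The rebuttal targets the conclusion of \<open>B'\<close> itself. It is stated
    for arbitrary arguments because either \<open>A\<close> or \<open>B\<close> may be the
    defeasible one.\<close>
  have no_rebut: "\<not> (is_defeasible B' \<and> opposite neg (conc A') (conc B'))"
    if "A' \<in> arguments AS" "Plain (Arg A') \<in> E" "B' \<in> arguments AS" "Plain (Arg B') \<in> E" for A' B'
  proof
    assume "is_defeasible B' \<and> opposite neg (conc A') (conc B')"
    then have "unrestrictedly_rebuts neg A' B'"
      unfolding unrestrictedly_rebuts_def using self_in_sub by blast
    then have "(Plain (Arg A'), Plain (Arg B')) \<in> af_att (flat (J_DA neg AS))"
      using that by (intro flat_att_ArgI) (auto simp: J_DA_def)
    then show False using adm that unfolding admissible_def conflict_free_def by blast
  qed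
  assume "opposite neg (conc A) (conc B)"
  with no_rebut[OF A B] no_rebut[OF B A] assms show False
    unfolding consistent_def is_strict_def by (metis opposite_commute)
qed

end

theorem theorem4p6:
  fixes \<sigma> :: "'l argument meta semantics"
    and neg :: "'l \<Rightarrow> 'l" and L :: "'l set"
    and AS :: "'l arg_system" and C :: "'l set"
  assumes "is_semantics \<sigma>" and "admissibility_based \<sigma>"
    and "closed_under_neg neg L"
    and "arg_system_over L AS" and "consistent neg AS"
    and "C \<in> DA_conclusions neg AS (sup_sem \<sigma>)"
  shows "strict_closure (srules AS) C = C \<and>
    \<not> (\<exists>\<phi>. \<phi> \<in> C \<and> neg \<phi> \<in> C) \<and>
    \<not> (\<exists>\<phi>. \<phi> \<in> strict_closure (srules AS) C \<and> neg \<phi> \<in> strict_closure (srules AS) C)"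
proof -
  obtain E where "E \<in> \<sigma> (flat (J_DA neg AS))"
    and C: "C = conc ` {A \<in> arguments AS. Plain (Arg A) \<in> E}"
    using assms(6) unfolding DA_conclusions_def sup_sem_def by (auto simp: J_DA_def)
  then have adm: "admissible (flat (J_DA neg AS)) E"
    using assms(2) is_af_flat unfolding admissibility_based_def by blast
  have closed: "strict_closure (srules AS) C = C"
    unfolding C by (rule strict_closure_admissible_conclusions[OF adm])
  have "\<not> (\<exists>\<phi>. \<phi> \<in> C \<and> neg \<phi> \<in> C)"
  proof
    assume "\<exists>\<phi>. \<phi> \<in> C \<and> neg \<phi> \<in> C"
    then obtain A B where "A \<in> arguments AS" "Plain (Arg A) \<in> E" "B \<in> arguments AS"
      "Plain (Arg B) \<in> E" "conc B = neg (conc A)"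
      unfolding C by auto
    then show False
      using admissible_conclusions_not_opposite[OF adm assms(5)] unfolding opposite_def by blast
  qed
  \<comment> \<open>Since \<open>C\<close> is its own closure, indirect consistency reduces to
    direct consistency.\<close>
  with closed show ?thesis by simp
qed

end
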